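(* Let $n\ge1$, let $k_1,\dots,k_n$ be even natural numbers, let $f_j\in S_{k_j}(SL_2(\mathbb Z))$ for $1\le j\le n$, and let $a,b\ge0$ be integers with $a+b=n$. Then the polynomials of multiperiods satisfy the shuffle relation $$\sum_{\sigma\in\mathfrak S_{a,b}}P^{\sigma}_{f_1,\dots,f_n}(X_1,\dots,X_n)=P_{f_1,\dots,f_a}(X_1,\dots,X_a)\,P_{f_{a+1},\dots,f_{a+b}}(X_{a+1},\dots,X_{a+b}),$$ where $\mathfrak S_{a,b}$ is the set of $\sigma\in\mathfrak S_n$ such that $\sigma(1)<\dots<\sigma(a)$ and $\sigma(a+1)<\dots<\sigma(a+b)$.
   Context: $S_k(SL_2(\mathbb Z))$ is the space of holomorphic cusp forms of weight $k$ and level $1$, and $\mathfrak S_n$ is the symmetric group on $\{1,\dots,n\}$. For such forms $f_1,\dots,f_n$ of weights $k_1,\dots,k_n$ the polynomial of multiperiods is $$P_{f_1,\dots,f_n}(X_1,\dots,X_n)=\int_{0<t_1<\dots<t_n}f_1(it_1)(X_1-it_1)^{k_1-2}\cdots f_n(it_n)(X_n-it_n)^{k_n-2}\,dt_1\cdots dt_n,$$ with the value $1$ for the empty family, and for $\sigma\in\mathfrak S_n$ $$P^\sigma_{f_1,\dots,f_n}(X_1,\dots,X_n)=P_{f_{\sigma(1)},\dots,f_{\sigma(n)}}(X_{\sigma(1)},\dots,X_{\sigma(n)}).$$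
   Formalization: The sum is over P^{σ^{-1}} instead of P^σ for σ in S_{a,b}; with the definitions as printed the relation fails (a=1, b=2, all f_j=Δ). Polynomials are treated as functions of complex X_1,…,X_n. *)

theory Defs
  imports "HOL-Complex_Analysis.Complex_Analysis" "HOL-Combinatorics.Permutations"
begin

definition upper_half_plane :: "complex set" where
  "upper_half_plane = {z. Im z > 0}"

(* Forms are functions on the whole complex type; only their values on the upper half plane
   matter. The last clause is holomorphy and vanishing at the cusp: a q-expansion without
   constant term. *)
definition cusp_forms :: "nat \<Rightarrow> (complex \<Rightarrow> complex) set" where
  "cusp_forms k = {f. f holomorphic_on upper_half_plane \<and>
     (\<forall>a b c d :: int. a * d - b * c = 1 \<longrightarrow>
        (\<forall>z\<in>upper_half_plane.
           f ((of_int a * z + of_int b) / (of_int c * z + of_int d)) =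
             (of_int c * z + of_int d) ^ k * f z)) \<and>
     (\<exists>q. q 0 = 0 \<and>
        (\<forall>z\<in>upper_half_plane.
           (\<lambda>m. q m * exp (2 * complex_of_real pi * \<i> * of_nat m * z)) sums f z))}"

definition ordered_chamber :: "nat \<Rightarrow> (nat \<Rightarrow> real) set" where
  "ordered_chamber n = {t. (\<forall>i\<in>{1..n}. 0 < t i) \<and> strict_mono_on {1..n} t}"

(* Polynomials in X_1, ..., X_n over the complex numbers are represented by the functions they
   induce on n-tuples of complex numbers. Only the values of k, f, X at 1, ..., n matter.
   The exponent k j - 2 is truncated for k j = 0, which is harmless because a cusp form of
   weight 0 vanishes on the upper half plane. *)
definition multiperiod ::
  "nat \<Rightarrow> (nat \<Rightarrow> nat) \<Rightarrow> (nat \<Rightarrow> complex \<Rightarrow> complex) \<Rightarrow> (nat \<Rightarrow> complex) \<Rightarrow> complex" where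
  "multiperiod n k f X =
     set_lebesgue_integral (Pi\<^sub>M {1..n} (\<lambda>_. lborel)) (ordered_chamber n)
       (\<lambda>t. \<Prod>j=1..n. f j (\<i> * of_real (t j)) * (X j - \<i> * of_real (t j)) ^ (k j - 2))"

lemma multiperiod_empty: "multiperiod 0 k f X = 1"
proof -
  have "multiperiod 0 k f X = (LINT t|Pi\<^sub>M ({} :: nat set) (\<lambda>_. lborel :: real measure). (1::complex))"
    by (simp add: multiperiod_def set_lebesgue_integral_def ordered_chamber_def
        strict_mono_on_def)
  also have "\<dots> = 1"
    unfolding PiM_empty by (simp add: lebesgue_integral_count_space_finite)
  finally show ?thesis .
qed

definition multiperiod_perm ::
  "(nat \<Rightarrow> nat) \<Rightarrow> nat \<Rightarrow> (nat \<Rightarrow> nat) \<Rightarrow> (nat \<Rightarrow> complex \<Rightarrow> complex) \<Rightarrow> (nat \<Rightarrow> complex) \<Rightarrow> complex"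
where
  "multiperiod_perm \<sigma> n k f X =
     multiperiod n (\<lambda>j. k (\<sigma> j)) (\<lambda>j. f (\<sigma> j)) (\<lambda>j. X (\<sigma> j))"

(* The elements are increasing on both blocks, so \<sigma> j is the position that letter j
   takes in the shuffled word. The word is therefore f (inv \<sigma> 1), ..., f (inv \<sigma> n), and its
   multiperiod polynomial is multiperiod_perm (inv \<sigma>). The inverse cannot be dropped: for
   a = 1 and b = 2, the permutation with values 3, 1, 2 must contribute the word f 2, f 3, f 1
   and not f 3, f 1, f 2, and the shuffle relation fails with the latter
   (for example for f 1 = f 2 = f 3 = Delta, the discriminant form of weight 12). *)
definition shuffle_perms :: "nat \<Rightarrow> nat \<Rightarrow> (nat \<Rightarrow> nat) set" where
  "shuffle_perms a b = {\<sigma>. \<sigma> permutes {1..a+b} \<and>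
     strict_mono_on {1..a} \<sigma> \<and> strict_mono_on {a+1..a+b} \<sigma>}"

end

theory Submission
  imports Defs "HOL-Probability.Sinc_Integral"
begin

text \<open>
  Put \<open>\<phi>\<^sub>j(t) = f\<^sub>j(it) (X\<^sub>j - it)\<close> to the power \<open>k\<^sub>j - 2\<close>, extended by 0 to \<open>t \<le> 0\<close>.
  Renaming the variables turns the term of a shuffle \<open>\<sigma>\<close> into the integral of
  \<open>\<phi>\<^sub>1(s\<^sub>1) \<cdots> \<phi>\<^sub>n(s\<^sub>n)\<close> over those \<open>s\<close> whose coordinates are ordered like the values
  of \<open>\<sigma>\<close>. A point with distinct coordinates is sorted by exactly one permutation, and this
  permutation is a shuffle if and only if both blocks of coordinates are increasing. So, off the
  null set of points with two equal coordinates, the chambers of the shuffles partition the product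
  of the two small chambers, and Fubini gives the result. Absolute convergence holds because a cusp
  form decays exponentially at infinity (by the q-expansion), hence also towards 0 (by
  \<open>z \<mapsto> -1/z\<close>).
\<close>

section \<open>Reindexing finite product measures\<close>

text \<open>A finite product measure is determined by its values on boxes. The preimage of a box
  under the renaming is again a box, with its sides permuted by the inverse of \<open>h\<close>, so
  both measures give the same product of side measures.\<close>

lemma distr_PiM_reindex_bij:
  assumes M: "sigma_finite_measure M" and fin: "finite I" and bij: "bij_betw h J I"
  shows "distr (Pi\<^sub>M I (\<lambda>_. M)) (Pi\<^sub>M J (\<lambda>_. M)) (\<lambda>t. \<lambda>j\<in>J. t (h j)) = Pi\<^sub>M J (\<lambda>_. M)"
proof -
  interpret product_sigma_finite "\<lambda>_. M"
    using M by (simp add: product_sigma_finite_def)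
  have finJ: "finite J"
    using bij fin by (simp add: bij_betw_finite)
  have hI: "h j \<in> I" if "j \<in> J" for j
    using bij that by (auto dest: bij_betwE)
  have meas: "(\<lambda>t. \<lambda>j\<in>J. t (h j)) \<in> measurable (Pi\<^sub>M I (\<lambda>_. M)) (Pi\<^sub>M J (\<lambda>_. M))"
    by (intro measurable_restrict measurable_component_singleton hI)
  let ?g = "the_inv_into J h"
  have inj: "inj_on h J"
    using bij by (simp add: bij_betw_def)
  have g: "?g (h j) = j" if "j \<in> J" for j
    using inj that by (rule the_inv_into_f_f)
  have gJ: "?g i \<in> J" and hg: "h (?g i) = i" if "i \<in> I" for i
    using bij that by (auto simp: bij_betw_def the_inv_into_into f_the_inv_into_f)
  show ?thesis
  proof (rule PiM_eqI[OF finJ])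
    fix A assume A: "\<And>j. j \<in> J \<Longrightarrow> A j \<in> sets M"
    have "emeasure (distr (Pi\<^sub>M I (\<lambda>_. M)) (Pi\<^sub>M J (\<lambda>_. M)) (\<lambda>t. \<lambda>j\<in>J. t (h j))) (Pi\<^sub>E J A) =
        emeasure (Pi\<^sub>M I (\<lambda>_. M)) ((\<lambda>t. \<lambda>j\<in>J. t (h j)) -` Pi\<^sub>E J A \<inter> space (Pi\<^sub>M I (\<lambda>_. M)))"
      using A finJ by (intro emeasure_distr meas sets_PiM_I_finite) auto
    also have "(\<lambda>t. \<lambda>j\<in>J. t (h j)) -` Pi\<^sub>E J A \<inter> space (Pi\<^sub>M I (\<lambda>_. M)) = (\<Pi>\<^sub>E i\<in>I. A (?g i))"
    proof (intro set_eqI iffI)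
      fix t assume t: "t \<in> (\<lambda>t. \<lambda>j\<in>J. t (h j)) -` Pi\<^sub>E J A \<inter> space (Pi\<^sub>M I (\<lambda>_. M))"
      then have 1: "t (h j) \<in> A j" if "j \<in> J" for j
        using that by (auto simp: space_PiM PiE_iff)
      from t have "t \<in> extensional I"
        by (simp add: space_PiM PiE_iff)
      then show "t \<in> (\<Pi>\<^sub>E i\<in>I. A (?g i))"
        using 1[OF gJ] hg by (auto simp: PiE_iff)
    next
      fix t assume t: "t \<in> (\<Pi>\<^sub>E i\<in>I. A (?g i))"
      then have 1: "t i \<in> A (?g i)" if "i \<in> I" for i
        using that by (auto simp: PiE_iff)
      from t have "t \<in> extensional I"
        by (simp add: PiE_iff)
      then show "t \<in> (\<lambda>t. \<lambda>j\<in>J. t (h j)) -` Pi\<^sub>E J A \<inter> space (Pi\<^sub>M I (\<lambda>_. M))"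
        using 1 1[OF hI] g sets.sets_into_space[OF A[OF gJ]]
        by (auto simp: space_PiM PiE_iff subset_iff)
    qed
    also have "emeasure (Pi\<^sub>M I (\<lambda>_. M)) \<dots> = (\<Prod>i\<in>I. emeasure M (A (?g i)))"
      using A fin gJ by (intro emeasure_PiM) auto
    also have "\<dots> = (\<Prod>j\<in>J. emeasure M (A j))"
      using g by (subst prod.reindex_bij_betw[OF bij, symmetric]) simp
    finally show "emeasure (distr (Pi\<^sub>M I (\<lambda>_. M)) (Pi\<^sub>M J (\<lambda>_. M)) (\<lambda>t. \<lambda>j\<in>J. t (h j))) (Pi\<^sub>E J A) =
        (\<Prod>j\<in>J. emeasure M (A j))" .
  qed simp
qed

lemma integral_PiM_reindex_bij:
  fixes F :: "('j \<Rightarrow> 'a) \<Rightarrow> 'b :: {banach, second_countable_topology}"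
  assumes "sigma_finite_measure M" "finite I" "bij_betw h J I"
    and F: "F \<in> borel_measurable (Pi\<^sub>M J (\<lambda>_. M))"
  shows "(LINT t|Pi\<^sub>M J (\<lambda>_. M). F t) = (LINT s|Pi\<^sub>M I (\<lambda>_. M). F (\<lambda>j\<in>J. s (h j)))"
proof -
  have hI: "h j \<in> I" if "j \<in> J" for j
    using assms(3) that by (auto dest: bij_betwE)
  have "(LINT t|Pi\<^sub>M J (\<lambda>_. M). F t) =
      (LINT t|distr (Pi\<^sub>M I (\<lambda>_. M)) (Pi\<^sub>M J (\<lambda>_. M)) (\<lambda>t. \<lambda>j\<in>J. t (h j)). F t)"
    using assms by (simp add: distr_PiM_reindex_bij)
  also have "\<dots> = (LINT s|Pi\<^sub>M I (\<lambda>_. M). F (\<lambda>j\<in>J. s (h j)))"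
    by (intro integral_distr F measurable_restrict measurable_component_singleton hI)
  finally show ?thesis .
qed

text \<open>Fubini with coordinate \<open>i\<close> integrated first: once the other coordinates are
  fixed, the slice of the diagonal contains at most the point \<open>x j\<close>.\<close>

lemma AE_PiM_lborel_neq:
  assumes fin: "finite I" and "i \<in> I" "j \<in> I" "i \<noteq> j"
  shows "AE t in Pi\<^sub>M I (\<lambda>_. lborel :: real measure). t i \<noteq> t j"
proof -
  interpret product_sigma_finite "\<lambda>_. lborel :: real measure"
    by standard
  define K where "K = I - {i}"
  have I: "I = insert i K" "i \<notin> K" "finite K" "j \<in> K"
    using assms by (auto simp: K_def)
  let ?D = "{t \<in> space (Pi\<^sub>M I (\<lambda>_. lborel :: real measure)). t i = t j}"
  have D: "?D \<in> sets (Pi\<^sub>M I (\<lambda>_. lborel :: real measure))"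
    using assms(2,3) by measurable
  have "emeasure (Pi\<^sub>M I (\<lambda>_. lborel)) ?D = (\<integral>\<^sup>+ t. indicator ?D t \<partial>Pi\<^sub>M I (\<lambda>_. lborel))"
    using D by simp
  also have "\<dots> = (\<integral>\<^sup>+ x. \<integral>\<^sup>+ y. indicator ?D (x(i := y)) \<partial>lborel \<partial>Pi\<^sub>M K (\<lambda>_. lborel))"
    unfolding I(1) using D I by (intro product_nn_integral_insert) auto
  also have "\<dots> = (\<integral>\<^sup>+ x. 0 \<partial>Pi\<^sub>M K (\<lambda>_. lborel :: real measure))"
  proof (intro nn_integral_cong)
    \<comment> \<open>Here \<open>x\<close> is an arbitrary function, so \<open>x(i := y)\<close>
      may lie outside the product space. The slice is therefore only bounded by the indicator of
      \<open>{x j}\<close>, which suffices.\<close>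
    fix x :: "_ \<Rightarrow> real"
    have "(\<integral>\<^sup>+ y. indicator ?D (x(i := y)) \<partial>lborel) \<le> (\<integral>\<^sup>+ y. indicator {x j} y \<partial>lborel)"
      using assms(4) by (intro nn_integral_mono) (auto split: split_indicator)
    then show "(\<integral>\<^sup>+ y. indicator ?D (x(i := y)) \<partial>lborel) = 0"
      by simp
  qed
  finally have "?D \<in> null_sets (Pi\<^sub>M I (\<lambda>_. lborel))"
    using D by auto
  then show ?thesis
    by (rule AE_I') auto
qed

lemma AE_PiM_lborel_inj_on:
  assumes "finite I"
  shows "AE t in Pi\<^sub>M I (\<lambda>_. lborel :: real measure). inj_on t I"
proof -
  have "AE t in Pi\<^sub>M I (\<lambda>_. lborel :: real measure). \<forall>i\<in>I. \<forall>j\<in>I. i \<noteq> j \<longrightarrow> t i \<noteq> t j"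
    using assms by (auto intro!: AE_finite_allI AE_PiM_lborel_neq)
  then show ?thesis
    by eventually_elim (auto simp: inj_on_def)
qed

section \<open>Sorting permutations\<close>

lemma strict_mono_on_less_iff:
  fixes s :: "'a::linorder \<Rightarrow> 'b::linorder"
  assumes "strict_mono_on A s" "x \<in> A" "y \<in> A"
  shows "s x < s y \<longleftrightarrow> x < y"
  using assms by (metis linorder_neqE not_less_iff_gr_or_eq strict_mono_onD)

text \<open>The chamber of \<open>p\<close> consists of the points that \<open>p\<close> orders like
  its own values. In this form the condition can be restricted to a block of indices, which
  \<open>s \<circ> inv p\<close> does not allow directly.\<close>

lemma strict_mono_on_comp_inv_iff:
  fixes s :: "'a::linorder \<Rightarrow> 'b::linorder"
  assumes "p permutes A"
  shows "strict_mono_on A (s \<circ> inv p) \<longleftrightarrow> (\<forall>i\<in>A. \<forall>j\<in>A. s i < s j \<longleftrightarrow> p i < p j)"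
proof
  assume L: "strict_mono_on A (s \<circ> inv p)"
  show "\<forall>i\<in>A. \<forall>j\<in>A. s i < s j \<longleftrightarrow> p i < p j"
  proof (intro ballI)
    fix i j assume "i \<in> A" "j \<in> A"
    then show "s i < s j \<longleftrightarrow> p i < p j"
      using strict_mono_on_less_iff[OF L, of "p i" "p j"] assms
      by (simp add: permutes_in_image permutes_inverses)
  qed
next
  assume "\<forall>i\<in>A. \<forall>j\<in>A. s i < s j \<longleftrightarrow> p i < p j"
  then show "strict_mono_on A (s \<circ> inv p)"
    using assms by (auto intro!: strict_mono_onI simp: permutes_in_image permutes_inverses
        permutes_inv[THEN permutes_in_image])
qed

lemma sorting_perm_unique_exists:
  fixes s :: "nat \<Rightarrow> 'a::linorder"
  assumes inj: "inj_on s {1..n}"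
  shows "\<exists>!p. p permutes {1..n} \<and> strict_mono_on {1..n} (s \<circ> inv p)"
proof -
  let ?U = "{1..n}"
  \<comment> \<open>The sorting permutation is the rank function. Each index counts itself, so ranks
    start at 1; outside the range \<open>r\<close> is the identity, as \<open>permutes\<close>
    demands.\<close>
  define r where "r j = (if j \<in> ?U then card {i\<in>?U. s i \<le> s j} else j)" for j
  have r_less: "r i < r j" if "i \<in> ?U" "j \<in> ?U" "s i < s j" for i j
  proof -
    have "{l\<in>?U. s l \<le> s i} \<subset> {l\<in>?U. s l \<le> s j}"
    proof (rule psubsetI)
      show "{l\<in>?U. s l \<le> s i} \<subseteq> {l\<in>?U. s l \<le> s j}"
        using that by auto
      have "j \<in> {l\<in>?U. s l \<le> s j} - {l\<in>?U. s l \<le> s i}"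
        using that by auto
      then show "{l\<in>?U. s l \<le> s i} \<noteq> {l\<in>?U. s l \<le> s j}"
        by blast
    qed
    then show ?thesis
      using that by (simp add: r_def psubset_card_mono)
  qed
  have r_iff: "s i < s j \<longleftrightarrow> r i < r j" if "i \<in> ?U" "j \<in> ?U" for i j
    using r_less[OF that] r_less[OF that(2,1)] inj that
    by (metis inj_onD linorder_neqE not_less_iff_gr_or_eq)
  have r_inj: "inj_on r ?U"
    using r_iff inj by (intro inj_onI) (metis inj_onD linorder_neqE less_irrefl)
  have "r j \<in> ?U" if "j \<in> ?U" for j
  proof -
    have "card {i\<in>?U. s i \<le> s j} \<le> card ?U"
      by (intro card_mono) auto
    moreover have "card {i\<in>?U. s i \<le> s j} \<noteq> 0"
      using that by auto
    ultimately show ?thesis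
      using that unfolding r_def by (metis (no_types, lifting) One_nat_def Suc_leI
          atLeastAtMost_iff bot_nat_0.not_eq_extremum card_atLeastAtMost diff_Suc_1)
  qed
  then have "bij_betw r ?U ?U"
    using r_inj endo_inj_surj[of ?U r] by (simp add: bij_betw_def image_subset_iff)
  then have r_perm: "r permutes ?U"
    by (rule bij_imp_permutes) (auto simp: r_def)
  show ?thesis
  proof (intro ex1I[of _ r] conjI)
    show "strict_mono_on ?U (s \<circ> inv r)"
      unfolding strict_mono_on_comp_inv_iff[OF r_perm] using r_iff by blast
    fix p assume p: "p permutes ?U \<and> strict_mono_on ?U (s \<circ> inv p)"
    then have iff: "s i \<le> s j \<longleftrightarrow> p i \<le> p j" if "i \<in> ?U" "j \<in> ?U" for i j
      using that strict_mono_on_comp_inv_iff[of p ?U s] by (meson not_less)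
    show "p = r"
    proof
      fix j show "p j = r j"
      proof (cases "j \<in> ?U")
        case True
        then have pj: "p j \<in> ?U"
          using p by (metis permutes_in_image)
        \<comment> \<open>Uniqueness: a sorting permutation maps the indices with value at most
          \<open>s j\<close> onto an initial segment ending at \<open>p j\<close>, so
          \<open>p j\<close> is their number, the rank of \<open>j\<close>.\<close>
        have "p ` {i\<in>?U. s i \<le> s j} = {1..p j}"
        proof (intro set_eqI iffI)
          fix l assume "l \<in> p ` {i\<in>?U. s i \<le> s j}"
          then show "l \<in> {1..p j}"
            using iff True p permutes_in_image[of p ?U] by auto
        next
          fix l assume l: "l \<in> {1..p j}"
          then have "l \<in> ?U"
            using pj by auto
          then have "inv p l \<in> ?U" "p (inv p l) = l"
            using p by (auto simp: permutes_inverses simp del: atLeastAtMost_iff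
                dest: permutes_inv[THEN permutes_in_image])
          then show "l \<in> p ` {i\<in>?U. s i \<le> s j}"
            using iff[OF _ True, of "inv p l"] l by (intro image_eqI[of _ _ "inv p l"]) auto
        qed
        moreover have "inj_on p {i\<in>?U. s i \<le> s j}"
          using p by (meson inj_on_subset permutes_inj top_greatest)
        ultimately have "card {i\<in>?U. s i \<le> s j} = p j"
          by (metis card_image card_atLeastAtMost diff_Suc_1)
        then show ?thesis
          using True by (simp add: r_def)
      next
        case False
        then have "r j = j"
          unfolding r_def by (rule if_not_P)
        moreover have "p j = j"
          using p False by (blast intro: permutes_not_in)
        ultimately show ?thesis
          by simp
      qed
    qed
  qed (rule r_perm)
qed

text \<open>At most one summand is nonzero, the one of the sorting permutation \<open>r\<close>, and
  it occurs exactly if \<open>r\<close> is a shuffle. Since \<open>r\<close> and \<open>s\<close>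
  induce the same order on every block, this says that \<open>s\<close> increases on both
  blocks.\<close>

lemma sum_indicator_shuffle_perms:
  fixes s :: "nat \<Rightarrow> real"
  assumes inj: "inj_on s {1..a+b}"
  shows "(\<Sum>p\<in>shuffle_perms a b. indicator {s. strict_mono_on {1..a+b} (s \<circ> inv p)} s :: real) =
    indicator {s. strict_mono_on {1..a} s \<and> strict_mono_on {a+1..a+b} s} s"
proof -
  obtain r where r: "r permutes {1..a+b}" "strict_mono_on {1..a+b} (s \<circ> inv r)"
    and uniq: "\<And>p. p permutes {1..a+b} \<Longrightarrow> strict_mono_on {1..a+b} (s \<circ> inv p) \<Longrightarrow> p = r"
    using sorting_perm_unique_exists[OF inj] by blast
  have iff: "s i < s j \<longleftrightarrow> r i < r j" if "i \<in> {1..a+b}" "j \<in> {1..a+b}" for i j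
    using r that by (simp add: strict_mono_on_comp_inv_iff)
  have block: "strict_mono_on B s \<longleftrightarrow> strict_mono_on B r" if "B \<subseteq> {1..a+b}" for B
    using iff that by (auto simp: strict_mono_on_def subset_iff)
  have mem: "r \<in> shuffle_perms a b \<longleftrightarrow> strict_mono_on {1..a} s \<and> strict_mono_on {a+1..a+b} s"
    using r block[of "{1..a}"] block[of "{a+1..a+b}"] by (auto simp: shuffle_perms_def)
  have fin: "finite (shuffle_perms a b)"
    by (rule finite_subset[OF _ finite_permutations[of "{1..a+b}"]]) (auto simp: shuffle_perms_def)
  have "(\<Sum>p\<in>shuffle_perms a b. indicator {s. strict_mono_on {1..a+b} (s \<circ> inv p)} s :: real) =
      (\<Sum>p\<in>shuffle_perms a b. if p = r then 1 else 0)"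
  proof (intro sum.cong refl)
    fix p assume "p \<in> shuffle_perms a b"
    then have "strict_mono_on {1..a+b} (s \<circ> inv p) \<longleftrightarrow> p = r"
      using r uniq[of p] by (auto simp: shuffle_perms_def)
    then show "indicator {s. strict_mono_on {1..a+b} (s \<circ> inv p)} s = (if p = r then 1 else 0 :: real)"
      by (simp only: indicator_def mem_Collect_eq of_bool_def)
  qed
  also have "\<dots> = (if r \<in> shuffle_perms a b then 1 else 0)"
    using fin by simp
  finally show ?thesis
    by (simp add: mem indicator_def)
qed

section \<open>Shuffle relation for iterated integrals\<close>

text \<open>The index set is arbitrary so that the block \<open>{a+1..a+b}\<close> is covered too.
  Positivity of the variables is left to the integrands.\<close>

definition ordered_integral :: "nat set \<Rightarrow> (nat \<Rightarrow> real \<Rightarrow> complex) \<Rightarrow> complex" where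
  "ordered_integral I \<phi> = (LINT t|Pi\<^sub>M I (\<lambda>_. lborel).
     indicator {t. strict_mono_on I t} t *\<^sub>R (\<Prod>j\<in>I. \<phi> j (t j)))"

text \<open>The map \<open>h\<close> serves for two cases: \<open>inv p\<close> for the chamber of a
  permutation, and the identity for a block inside a larger index set.\<close>

lemma pred_strict_mono_on:
  assumes "finite I" "\<And>i. i \<in> I \<Longrightarrow> h i \<in> K"
  shows "Measurable.pred (Pi\<^sub>M K (\<lambda>_. lborel :: real measure)) (\<lambda>t. strict_mono_on (I :: nat set) (t \<circ> h))"
proof -
  have eq: "strict_mono_on I (t \<circ> h) \<longleftrightarrow> (\<forall>i\<in>I. \<forall>j\<in>I. i < j \<longrightarrow> t (h i) < t (h j))" for t :: "_ \<Rightarrow> real"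
    by (auto simp: strict_mono_on_def)
  have [measurable]: "(\<lambda>t. t (h i)) \<in> borel_measurable (Pi\<^sub>M K (\<lambda>_. lborel :: real measure))"
    if "i \<in> I" for i
    using measurable_component_singleton[OF assms(2)[OF that], of "\<lambda>_. lborel :: real measure"] by simp
  show ?thesis
    unfolding eq using assms(1) by (intro pred_intros_finite) measurable
qed

lemma integrable_PiM_indicator:
  fixes \<phi> :: "'i \<Rightarrow> real \<Rightarrow> complex"
  assumes "finite I" "\<And>j. j \<in> I \<Longrightarrow> integrable lborel (\<phi> j)"
    and "Measurable.pred (Pi\<^sub>M I (\<lambda>_. lborel)) P"
  shows "integrable (Pi\<^sub>M I (\<lambda>_. lborel)) (\<lambda>t. indicator {t. P t} t *\<^sub>R (\<Prod>j\<in>I. \<phi> j (t j)))"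
proof -
  interpret product_sigma_finite "\<lambda>_. lborel :: real measure"
    by standard
  let ?M = "Pi\<^sub>M I (\<lambda>_. lborel :: real measure)"
  \<comment> \<open>The set of all \<open>t\<close> with \<open>P t\<close> may contain functions
    outside the product space, so measurability is available only for its intersection with the
    space; the two indicators agree there.\<close>
  have "{t \<in> space ?M. P t} \<in> sets ?M"
    using assms(3) by simp
  then have "integrable ?M (\<lambda>t. indicator {t \<in> space ?M. P t} t *\<^sub>R (\<Prod>j\<in>I. \<phi> j (t j)))"
    using product_integrable_prod[OF assms(1,2)] by (rule integrable_mult_indicator)
  then show ?thesis
    by (rule Bochner_Integration.integrable_cong[THEN iffD1, rotated 2]) (auto simp: indicator_def)
qed

lemma integrable_ordered:
  fixes \<phi> :: "nat \<Rightarrow> real \<Rightarrow> complex"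
  assumes "finite I" "\<And>j. j \<in> I \<Longrightarrow> integrable lborel (\<phi> j)"
  shows "integrable (Pi\<^sub>M I (\<lambda>_. lborel))
    (\<lambda>t. indicator {t. strict_mono_on I t} t *\<^sub>R (\<Prod>j\<in>I. \<phi> j (t j)))"
  using pred_strict_mono_on[of I "\<lambda>i. i" I] assms
  by (intro integrable_PiM_indicator) (simp_all add: comp_def)

text \<open>Under the substitution \<open>t j = s (h j)\<close> the product no longer depends on
  \<open>h\<close>, which survives only in the indicator. This makes the terms of different shuffles
  comparable.\<close>

lemma ordered_integral_reindex:
  fixes \<phi> :: "nat \<Rightarrow> real \<Rightarrow> complex" and h :: "nat \<Rightarrow> nat"
  assumes "finite I" "bij_betw h J I" "\<And>i. i \<in> I \<Longrightarrow> integrable lborel (\<phi> i)"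
  shows "ordered_integral J (\<lambda>j. \<phi> (h j)) = (LINT s|Pi\<^sub>M I (\<lambda>_. lborel).
    indicator {s. strict_mono_on J (s \<circ> h)} s *\<^sub>R (\<Prod>i\<in>I. \<phi> i (s i)))"
proof -
  have finJ: "finite J"
    using assms(1,2) by (simp add: bij_betw_finite)
  have hI: "h j \<in> I" if "j \<in> J" for j
    using assms(2) that by (auto dest: bij_betwE)
  have sm: "strict_mono_on J (\<lambda>j\<in>J. s (h j)) \<longleftrightarrow> strict_mono_on J (s \<circ> h)" for s :: "nat \<Rightarrow> real"
    by (auto simp: strict_mono_on_def)
  have "ordered_integral J (\<lambda>j. \<phi> (h j)) = (LINT s|Pi\<^sub>M I (\<lambda>_. lborel).
      indicator {t. strict_mono_on J t} (\<lambda>j\<in>J. s (h j)) *\<^sub>R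
        (\<Prod>j\<in>J. \<phi> (h j) ((\<lambda>j\<in>J. s (h j)) j)))"
    unfolding ordered_integral_def
    using assms hI finJ integrable_ordered[of J "\<lambda>j. \<phi> (h j)"]
    by (intro integral_PiM_reindex_bij sigma_finite_lborel) auto
  also have "\<dots> = (LINT s|Pi\<^sub>M I (\<lambda>_. lborel).
      indicator {s. strict_mono_on J (s \<circ> h)} s *\<^sub>R (\<Prod>i\<in>I. \<phi> i (s i)))"
  proof (rule Bochner_Integration.integral_cong[OF refl])
    fix s :: "nat \<Rightarrow> real"
    have "(\<Prod>j\<in>J. \<phi> (h j) ((\<lambda>j\<in>J. s (h j)) j)) = (\<Prod>j\<in>J. \<phi> (h j) (s (h j)))"
      by simp
    also have "\<dots> = (\<Prod>i\<in>I. \<phi> i (s i))"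
      by (rule prod.reindex_bij_betw[OF assms(2)])
    finally show "indicator {t. strict_mono_on J t} (\<lambda>j\<in>J. s (h j)) *\<^sub>R
        (\<Prod>j\<in>J. \<phi> (h j) ((\<lambda>j\<in>J. s (h j)) j)) =
      indicator {s. strict_mono_on J (s \<circ> h)} s *\<^sub>R (\<Prod>i\<in>I. \<phi> i (s i))"
      by (simp add: indicator_def sm)
  qed
  finally show ?thesis .
qed

text \<open>Translation of the indices preserves their order. This links the second factor, numbered
  from 1, to its block of variables.\<close>

lemma ordered_integral_shift:
  assumes "\<And>i. i \<in> {a+1..a+b} \<Longrightarrow> integrable lborel (\<phi> i)"
  shows "ordered_integral {1..b} (\<lambda>j. \<phi> (a + j)) = ordered_integral {a+1..a+b} \<phi>"
proof -
  have bij: "bij_betw ((+) a) {1..b} {a+1..a+b}"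
    by (simp add: bij_betw_def)
  have "strict_mono_on {1..b} (s \<circ> (+) a) \<longleftrightarrow> strict_mono_on {a+1..a+b} s" for s :: "nat \<Rightarrow> real"
  proof
    assume L: "strict_mono_on {1..b} (s \<circ> (+) a)"
    show "strict_mono_on {a+1..a+b} s"
    proof (rule strict_mono_onI)
      fix i j assume "i \<in> {a+1..a+b}" "j \<in> {a+1..a+b}" "i < j"
      then show "s i < s j"
        using strict_mono_onD[OF L, of "i - a" "j - a"] by auto
    qed
  qed (auto simp: strict_mono_on_def)
  then show ?thesis
    using ordered_integral_reindex[OF _ bij assms] by (simp add: ordered_integral_def)
qed

text \<open>No condition relates the variables of \<open>I\<close> to those of \<open>J\<close>, so
  the integrand splits at merged points and Fubini separates the integrals.\<close>

lemma ordered_integral_mult: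
  fixes \<phi> :: "nat \<Rightarrow> real \<Rightarrow> complex"
  assumes IJ: "I \<inter> J = {}" "finite I" "finite J"
    and \<phi>: "\<And>j. j \<in> I \<union> J \<Longrightarrow> integrable lborel (\<phi> j)"
  shows "(LINT s|Pi\<^sub>M (I \<union> J) (\<lambda>_. lborel).
      indicator {s. strict_mono_on I s \<and> strict_mono_on J s} s *\<^sub>R (\<Prod>j\<in>I \<union> J. \<phi> j (s j))) =
    ordered_integral I \<phi> * ordered_integral J \<phi>"
proof -
  interpret product_sigma_finite "\<lambda>_. lborel :: real measure"
    by standard
  let ?F = "\<lambda>K t. indicator {t. strict_mono_on K t} t *\<^sub>R (\<Prod>j\<in>K. \<phi> j (t j))"
  let ?G = "\<lambda>s. indicator {s. strict_mono_on I s \<and> strict_mono_on J s} s *\<^sub>R (\<Prod>j\<in>I \<union> J. \<phi> j (s j))"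
  have split: "?G (merge I J (x, y)) = ?F I x * ?F J y" for x y :: "nat \<Rightarrow> real"
  proof -
    have "strict_mono_on I (merge I J (x, y)) \<longleftrightarrow> strict_mono_on I x"
      "strict_mono_on J (merge I J (x, y)) \<longleftrightarrow> strict_mono_on J y"
      using IJ(1) by (auto simp: strict_mono_on_def merge_def disjoint_iff)
    moreover have "(\<Prod>j\<in>I. \<phi> j (merge I J (x, y) j)) = (\<Prod>j\<in>I. \<phi> j (x j))"
      "(\<Prod>j\<in>J. \<phi> j (merge I J (x, y) j)) = (\<Prod>j\<in>J. \<phi> j (y j))"
      using IJ(1) by (auto intro!: prod.cong simp: merge_def)
    ultimately show ?thesis
      using IJ by (cases "strict_mono_on I x"; cases "strict_mono_on J y")
        (simp_all add: prod.union_disjoint)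
  qed
  have "integrable (Pi\<^sub>M (I \<union> J) (\<lambda>_. lborel)) ?G"
    using pred_strict_mono_on[of I "\<lambda>i. i" "I \<union> J"] pred_strict_mono_on[of J "\<lambda>i. i" "I \<union> J"] IJ \<phi>
    by (intro integrable_PiM_indicator pred_intros_logic) (simp_all add: comp_def)
  then have "integral\<^sup>L (Pi\<^sub>M (I \<union> J) (\<lambda>_. lborel)) ?G =
      (LINT x|Pi\<^sub>M I (\<lambda>_. lborel). LINT y|Pi\<^sub>M J (\<lambda>_. lborel). ?F I x * ?F J y)"
    using IJ by (subst product_integral_fold) (simp_all only: split)
  also have "\<dots> = ordered_integral I \<phi> * ordered_integral J \<phi>"
    unfolding ordered_integral_def by (simp only: integral_mult_left_zero integral_mult_right_zero)
  finally show ?thesis .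
qed

text \<open>The shuffle relation for arbitrary integrable functions of one variable; cusp forms will
  enter only through integrability.\<close>

theorem shuffle_ordered_integral:
  fixes \<phi> :: "nat \<Rightarrow> real \<Rightarrow> complex"
  assumes \<phi>: "\<And>j. j \<in> {1..a+b} \<Longrightarrow> integrable lborel (\<phi> j)"
  shows "(\<Sum>p\<in>shuffle_perms a b. ordered_integral {1..a+b} (\<lambda>j. \<phi> (inv p j))) =
    ordered_integral {1..a} \<phi> * ordered_integral {1..b} (\<lambda>j. \<phi> (a + j))"
proof -
  let ?U = "{1..a+b}"
  let ?\<Phi> = "\<lambda>s :: nat \<Rightarrow> real. \<Prod>j\<in>?U. \<phi> j (s j)"
  let ?M = "Pi\<^sub>M ?U (\<lambda>_. lborel :: real measure)"
  let ?T = "\<lambda>p s. indicator {s. strict_mono_on ?U (s \<circ> inv p)} s :: real"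
  have perm: "inv p permutes ?U" if "p \<in> shuffle_perms a b" for p
    using that by (simp add: shuffle_perms_def permutes_inv)
  have int: "integrable (?M) (\<lambda>s. ?T p s *\<^sub>R ?\<Phi> s)" if "p \<in> shuffle_perms a b" for p
    using perm[OF that] by (intro integrable_PiM_indicator pred_strict_mono_on \<phi>)
      (auto simp: permutes_in_image simp del: atLeastAtMost_iff)
  have U: "?U = {1..a} \<union> {a+1..a+b}"
    by auto
  \<comment> \<open>All terms become integrals of the same product \<open>?\<Phi>\<close> over the
    same space, so only the indicators have to be added.\<close>
  have "(\<Sum>p\<in>shuffle_perms a b. ordered_integral ?U (\<lambda>j. \<phi> (inv p j))) =
      (\<Sum>p\<in>shuffle_perms a b. integral\<^sup>L ?M (\<lambda>s. ?T p s *\<^sub>R ?\<Phi> s))"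
    using perm \<phi> by (intro sum.cong refl ordered_integral_reindex) (auto intro: permutes_imp_bij)
  also have "\<dots> = integral\<^sup>L ?M (\<lambda>s. \<Sum>p\<in>shuffle_perms a b. ?T p s *\<^sub>R ?\<Phi> s)"
    using int by (rule Bochner_Integration.integral_sum[symmetric])
  also have "\<dots> = integral\<^sup>L ?M (\<lambda>s.
      indicator {s. strict_mono_on {1..a} s \<and> strict_mono_on {a+1..a+b} s} s *\<^sub>R ?\<Phi> s)"
  proof (rule integral_cong_AE)
    \<comment> \<open>Equality can fail where a coordinate of one block equals one of the other:
      such a point lies in no shuffle chamber but possibly in the product of the two
      chambers.\<close>
    show "AE s in ?M. (\<Sum>p\<in>shuffle_perms a b. ?T p s *\<^sub>R ?\<Phi> s) =
        indicator {s. strict_mono_on {1..a} s \<and> strict_mono_on {a+1..a+b} s} s *\<^sub>R ?\<Phi> s"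
      using AE_PiM_lborel_inj_on[OF finite_atLeastAtMost]
      by eventually_elim (simp only: sum_indicator_shuffle_perms scaleR_sum_left[symmetric])
    show "(\<lambda>s. \<Sum>p\<in>shuffle_perms a b. ?T p s *\<^sub>R ?\<Phi> s) \<in> borel_measurable (?M)"
      using int by (intro borel_measurable_sum borel_measurable_integrable)
    have "integrable (?M) (\<lambda>s.
        indicator {s. strict_mono_on {1..a} s \<and> strict_mono_on {a+1..a+b} s} s *\<^sub>R ?\<Phi> s)"
      using pred_strict_mono_on[of "{1..a}" "\<lambda>i. i" ?U]
        pred_strict_mono_on[of "{a+1..a+b}" "\<lambda>i. i" ?U] \<phi>
      by (intro integrable_PiM_indicator pred_intros_logic) (simp_all add: comp_def)
    then show "(\<lambda>s. indicator {s. strict_mono_on {1..a} s \<and> strict_mono_on {a+1..a+b} s} s *\<^sub>R ?\<Phi> s)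
        \<in> borel_measurable (?M)"
      by (rule borel_measurable_integrable)
  qed
  also have "\<dots> = ordered_integral {1..a} \<phi> * ordered_integral {a+1..a+b} \<phi>"
    unfolding U using \<phi> by (intro ordered_integral_mult) auto
  also have "ordered_integral {a+1..a+b} \<phi> = ordered_integral {1..b} (\<lambda>j. \<phi> (a + j))"
    using \<phi> by (intro ordered_integral_shift[symmetric]) auto
  finally show ?thesis .
qed

section \<open>Integrability of cusp forms along the imaginary axis\<close>

text \<open>One term of the exponential series is at most the whole sum. This trades powers for
  exponentials in the estimates below.\<close>

lemma power_le_fact_exp:
  fixes u :: real
  assumes "u \<ge> 0"
  shows "u ^ k \<le> fact k * exp u"
proof -
  have "u ^ k /\<^sub>R fact k \<le> (\<Sum>m. u ^ m /\<^sub>R fact m)"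
    using sum_le_suminf[OF summable_exp_generic[of u], of "{k}"] assms by simp
  then show ?thesis
    by (simp add: exp_def field_simps)
qed

text \<open>Every term of the q-expansion with \<open>m\<close> at least 1 decays at least like
  \<open>exp (- 2 * pi * t)\<close>. Part of this rate is given up to sum the series; the vanishing
  of \<open>q 0\<close> excludes a constant term, which would not decay.\<close>

lemma cusp_form_decay:
  assumes "f \<in> cusp_forms k"
  obtains C where "C \<ge> 0" "\<And>t. t \<ge> 1 \<Longrightarrow> norm (f (\<i> * complex_of_real t)) \<le> C * exp (- pi * t)"
proof -
  obtain q where q0: "q 0 = 0" and q: "\<And>z. Im z > 0 \<Longrightarrow>
      (\<lambda>m. q m * exp (2 * complex_of_real pi * \<i> * of_nat m * z)) sums f z"
    using assms by (auto simp: cusp_forms_def upper_half_plane_def)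
  have nrm: "norm (q m * exp (2 * complex_of_real pi * \<i> * of_nat m * (\<i> * complex_of_real t))) =
      norm (q m) * exp (- 2 * pi * m * t)" for m t
    by (simp add: norm_mult)
  \<comment> \<open>Convergence at i/2 bounds the coefficients well enough for a geometric majorant from i on.\<close>
  have "summable (\<lambda>m. q m * exp (2 * complex_of_real pi * \<i> * of_nat m * (\<i> * complex_of_real (1/2))))"
    by (rule sums_summable, rule q) simp
  then have "Bseq (\<lambda>m. q m * exp (2 * complex_of_real pi * \<i> * of_nat m * (\<i> * complex_of_real (1/2))))"
    by (intro convergent_imp_Bseq convergentI[OF summable_LIMSEQ_zero])
  then obtain B where B: "B > 0" "\<And>m. norm (q m) * exp (- 2 * pi * m * (1/2)) \<le> B"
    unfolding Bseq_def nrm by blast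
  define r where "r = exp (- pi)"
  have r: "0 < r" "r < 1"
    by (simp_all add: r_def)
  have "norm (f (\<i> * complex_of_real t)) \<le> (B * exp pi / (1 - r)) * exp (- pi * t)" if t: "t \<ge> 1" for t
  proof -
    let ?a = "\<lambda>m. q m * exp (2 * complex_of_real pi * \<i> * of_nat m * (\<i> * complex_of_real t))"
    have sums: "?a sums f (\<i> * complex_of_real t)"
      using t by (intro q) simp
    have le: "norm (?a m) \<le> B * exp pi * exp (- pi * t) * r ^ m" for m
    proof (cases "m = 0")
      case True
      then show ?thesis
        using q0 B r by simp
    next
      case False
      have "norm (?a m) = (norm (q m) * exp (- 2 * pi * m * (1/2))) * exp (pi * m - 2 * pi * m * t)"
        unfolding nrm by (simp add: mult.assoc flip: exp_add)
      also have "\<dots> \<le> B * exp (pi * m - 2 * pi * m * t)"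
        by (intro mult_right_mono B) simp
      also have "\<dots> \<le> B * exp (pi + (- pi * t) + m * (- pi))"
      proof -
        \<comment> \<open>The two products add up to \<open>(2 * m - 1) * (t - 1)\<close>, whose
          nonnegativity is the comparison of exponents needed.\<close>
        have "(real m - 1) * (t - 1) \<ge> 0" "m * (t - 1) \<ge> 0"
          using False t by auto
        then have "real m - 2 * m * t \<le> 1 - t - m"
          using t by (auto simp: algebra_simps)
        then have "pi * (real m - 2 * m * t) \<le> pi * (1 - t - m)"
          by (intro mult_left_mono) auto
        then show ?thesis
          using B(1) by (auto simp: algebra_simps)
      qed
      also have "\<dots> = B * exp pi * exp (- pi * t) * r ^ m"
        unfolding r_def by (simp only: exp_add exp_of_nat_mult mult.assoc)
      finally show ?thesis .
    qed
    have geo: "(\<lambda>m. B * exp pi * exp (- pi * t) * r ^ m) sums (B * exp pi * exp (- pi * t) * (1 / (1 - r)))"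
      using r by (intro sums_mult geometric_sums) simp
    have "norm (f (\<i> * complex_of_real t)) \<le> B * exp pi * exp (- pi * t) * (1 / (1 - r))"
      using norm_suminf_le[OF le sums_summable[OF geo]] sums_unique[OF sums] sums_unique[OF geo] by simp
    then show ?thesis
      by (simp add: mult_ac)
  qed
  moreover have "B * exp pi / (1 - r) \<ge> 0"
    using B r by simp
  ultimately show thesis
    using that by blast
qed

lemma cusp_form_inversion:
  assumes "f \<in> cusp_forms k" "t > 0"
  shows "f (\<i> * complex_of_real (1 / t)) = (\<i> * complex_of_real t) ^ k * f (\<i> * complex_of_real t)"
proof -
  have inv: "\<forall>a b c d :: int. a * d - b * c = 1 \<longrightarrow> (\<forall>z\<in>upper_half_plane.
      f ((of_int a * z + of_int b) / (of_int c * z + of_int d)) = (of_int c * z + of_int d) ^ k * f z)"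
    using assms(1) by (simp add: cusp_forms_def)
  have "\<i> * complex_of_real t \<in> upper_half_plane"
    using assms(2) by (simp add: upper_half_plane_def)
  \<comment> \<open>The values are those of \<open>a\<close>, \<open>d\<close>, \<open>b\<close>,
    \<open>c\<close> in this order: the matrix with rows 0, -1 and 1, 0, which acts as
    \<open>z \<mapsto> -1/z\<close>.\<close>
  from inv[rule_format, OF _ this, of 0 0 "-1" 1]
  have "f (- 1 / (\<i> * complex_of_real t)) = (\<i> * complex_of_real t) ^ k * f (\<i> * complex_of_real t)"
    by simp
  moreover have "- 1 / (\<i> * complex_of_real t) = \<i> * complex_of_real (1 / t)"
    using assms(2) by (simp add: field_simps)
  ultimately show ?thesis
    by simp
qed

text \<open>From 1 on, the decay rate \<open>pi\<close> exceeds 2. Below 1, inversion expresses the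
  value at \<open>t\<close> by the decaying value at \<open>1 / t\<close>, and boundedness is enough
  there. The rate 2 leaves room for a polynomial factor.\<close>

lemma cusp_form_exp_bound:
  assumes f: "f \<in> cusp_forms k"
  obtains C where "C \<ge> 0" "\<And>t. t > 0 \<Longrightarrow> norm (f (\<i> * complex_of_real t)) \<le> C * exp (- 2 * t)"
proof -
  obtain C where C: "C \<ge> 0" "\<And>t. t \<ge> 1 \<Longrightarrow> norm (f (\<i> * complex_of_real t)) \<le> C * exp (- pi * t)"
    using cusp_form_decay[OF f] by blast
  \<comment> \<open>The factor \<open>fact k\<close> pays for the automorphy factor
    \<open>u ^ k\<close> with \<open>u = 1 / t\<close>, and \<open>exp 2\<close> turns a constant
    bound for \<open>t < 1\<close> into a multiple of \<open>exp (- 2 * t)\<close>.\<close>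
  have "norm (f (\<i> * complex_of_real t)) \<le> (C * fact k * exp 2) * exp (- 2 * t)" if t: "t > 0" for t
  proof (cases "t \<ge> 1")
    case True
    have "norm (f (\<i> * complex_of_real t)) \<le> C * exp (- pi * t)"
      by (rule C) fact
    also have "\<dots> \<le> C * exp (- 2 * t)"
      using C(1) t pi_gt3 by (intro mult_left_mono) auto
    also have "\<dots> \<le> C * (fact k * exp 2) * exp (- 2 * t)"
    proof -
      have "1 * 1 \<le> fact k * exp (2::real)"
        by (intro mult_mono) auto
      then have "C * 1 \<le> C * (fact k * exp 2)"
        using C(1) by (intro mult_left_mono) auto
      then show ?thesis
        by (intro mult_right_mono) auto
    qed
    finally show ?thesis
      by (simp add: mult.assoc)
  next
    case False
    define u where "u = 1 / t"
    have u: "u \<ge> 1" "t * u = 1"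
      using t False by (auto simp: u_def)
    have "norm (f (\<i> * complex_of_real u)) = t ^ k * norm (f (\<i> * complex_of_real t))"
      using t unfolding u_def cusp_form_inversion[OF f t] by (simp add: norm_mult norm_power)
    then have "norm (f (\<i> * complex_of_real t)) = u ^ k * norm (f (\<i> * complex_of_real u))"
      using u by (simp add: mult.assoc[symmetric] power_mult_distrib[symmetric] mult.commute[of u])
    also have "\<dots> \<le> (fact k * exp u) * (C * exp (- pi * u))"
      using u C(1) by (intro mult_mono power_le_fact_exp C(2)) auto
    also have "\<dots> = C * fact k * exp (u - pi * u)"
      by (simp add: exp_diff exp_minus field_simps)
    also have "\<dots> \<le> C * fact k * exp (2 - 2 * t)"
    proof -
      have "u * 1 \<le> u * pi"
        using u pi_gt3 by (intro mult_left_mono) auto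
      then have "u - pi * u \<le> 2 - 2 * t"
        using False by (simp add: mult.commute)
      then show ?thesis
        using C(1) by (intro mult_left_mono) auto
    qed
    also have "\<dots> = (C * fact k * exp 2) * exp (- 2 * t)"
      by (simp flip: exp_add)
    finally show ?thesis .
  qed
  then show thesis
    using that[of "C * fact k * exp 2"] C(1) by simp
qed

text \<open>The polynomial factor is at most a constant times \<open>exp t\<close>, which uses up
  half of the rate 2 and leaves the integrable majorant \<open>D * exp (- t)\<close>. Measurability
  comes from continuity on the open half-line.\<close>

lemma integrable_cusp_form_polynomial:
  assumes f: "f \<in> cusp_forms k"
  shows "integrable lborel (\<lambda>t. indicator {0<..} t *\<^sub>R
    (f (\<i> * complex_of_real t) * (x - \<i> * complex_of_real t) ^ m))"
proof -
  let ?g = "\<lambda>t. f (\<i> * complex_of_real t) * (x - \<i> * complex_of_real t) ^ m"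
  obtain C where C: "C \<ge> 0" "\<And>t. t > 0 \<Longrightarrow> norm (f (\<i> * complex_of_real t)) \<le> C * exp (- 2 * t)"
    using cusp_form_exp_bound[OF f] by blast
  define D where "D = C * fact m * exp (norm x)"
  have bound: "norm (?g t) \<le> D * exp (- t)" if t: "t > 0" for t
  proof -
    have "norm (x - \<i> * complex_of_real t) \<le> norm x + t"
      using norm_triangle_ineq4[of x "\<i> * complex_of_real t"] t by (simp add: norm_mult)
    then have "norm (x - \<i> * complex_of_real t) ^ m \<le> (norm x + t) ^ m"
      by (intro power_mono) auto
    also have "\<dots> \<le> fact m * exp (norm x + t)"
      using t by (intro power_le_fact_exp) auto
    finally have "norm (?g t) \<le> (C * exp (- 2 * t)) * (fact m * exp (norm x + t))"
      unfolding norm_mult norm_power using C(1) t by (intro mult_mono C) auto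
    also have "\<dots> = D * (exp (- 2 * t) * exp t)"
      by (simp add: D_def exp_add)
    also have "exp (- 2 * t) * exp t = exp (- t)"
      by (simp flip: exp_add)
    finally show ?thesis .
  qed
  have "continuous_on {0<..} ?g"
  proof (intro continuous_intros)
    have "continuous_on upper_half_plane f"
      using f by (auto simp: cusp_forms_def intro: holomorphic_on_imp_continuous_on)
    then show "continuous_on {0<..} (\<lambda>t. f (\<i> * complex_of_real t))"
      by (rule continuous_on_compose2) (auto intro!: continuous_intros simp: upper_half_plane_def)
  qed
  then have meas: "(\<lambda>t. indicator {0<..} t *\<^sub>R ?g t) \<in> borel_measurable lborel"
    using borel_measurable_continuous_on_indicator[of "{0<..}" ?g] by simp
  have "integrable lborel (\<lambda>t. D * (indicator {0<..} t *\<^sub>R exp (- (t * 1))))"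
    using integrable_I0i_exp_mscale[of 1] unfolding set_integrable_def
    by (intro integrable_mult_right) auto
  then show ?thesis
  proof (rule Bochner_Integration.integrable_bound[OF _ meas])
    show "AE t in lborel. norm (indicator {0<..} t *\<^sub>R ?g t) \<le>
        norm (D * (indicator {0<..} t *\<^sub>R exp (- (t * 1))) :: real)"
      using bound by (auto intro!: AE_I2 simp: indicator_def intro: order_trans[OF _ abs_ge_self])
  qed
qed

section \<open>Multiperiods as ordered integrals, and their shuffle relation\<close>

lemma multiperiod_eq_ordered_integral:
  "multiperiod n k f X = ordered_integral {1..n} (\<lambda>j t. indicator {0<..} t *\<^sub>R
    (f j (\<i> * complex_of_real t) * (X j - \<i> * complex_of_real t) ^ (k j - 2)))"
  unfolding multiperiod_def ordered_integral_def set_lebesgue_integral_def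
proof (rule Bochner_Integration.integral_cong[OF refl])
  fix t :: "nat \<Rightarrow> real"
  let ?g = "\<lambda>j. f j (\<i> * complex_of_real (t j)) * (X j - \<i> * complex_of_real (t j)) ^ (k j - 2)"
  show "indicator (ordered_chamber n) t *\<^sub>R (\<Prod>j=1..n. ?g j) =
    indicator {t. strict_mono_on {1..n} t} t *\<^sub>R (\<Prod>j=1..n. indicator {0<..} (t j) *\<^sub>R ?g j)"
  \<comment> \<open>Positivity moves from the chamber into cut-offs of the single factors, so that
    the domain involves only the order of the coordinates. If some coordinate is not positive, both
    sides vanish.\<close>
  proof (cases "\<forall>j\<in>{1..n}. 0 < t j")
    case True
    then have "(\<Prod>j=1..n. indicator {0<..} (t j) *\<^sub>R ?g j) = (\<Prod>j=1..n. ?g j)"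
      by (intro prod.cong) auto
    moreover have "t \<in> ordered_chamber n \<longleftrightarrow> strict_mono_on {1..n} t"
      using True by (simp add: ordered_chamber_def)
    ultimately show ?thesis
      by (simp add: indicator_def)
  next
    case False
    then have "\<exists>j\<in>{1..n}. indicator {0<..} (t j) *\<^sub>R ?g j = 0"
      by (auto simp: indicator_def)
    then have "(\<Prod>j=1..n. indicator {0<..} (t j) *\<^sub>R ?g j) = 0"
      by (intro prod_zero) auto
    moreover have "t \<notin> ordered_chamber n"
      using False by (auto simp: ordered_chamber_def)
    ultimately show ?thesis
      by simp
  qed
qed

theorem proposition0p5:
  fixes n a b :: nat
    and k :: "nat \<Rightarrow> nat"
    and f :: "nat \<Rightarrow> complex \<Rightarrow> complex"
    and X :: "nat \<Rightarrow> complex"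
  assumes "n \<ge> 1"
    and "\<And>j. j \<in> {1..n} \<Longrightarrow> even (k j)"
    and "\<And>j. j \<in> {1..n} \<Longrightarrow> f j \<in> cusp_forms (k j)"
    and "a + b = n"
  shows "(\<Sum>\<sigma>\<in>shuffle_perms a b. multiperiod_perm (inv \<sigma>) n k f X) =
    multiperiod a k f X *
    multiperiod b (\<lambda>j. k (a + j)) (\<lambda>j. f (a + j)) (\<lambda>j. X (a + j))"
  \<comment> \<open>Composing \<open>k\<close>, \<open>f\<close> and \<open>X\<close> with
    \<open>inv \<sigma>\<close> or with the shift by \<open>a\<close> composes the family of
    one-variable integrands with the same map, which is the shape of the shuffle relation for
    ordered integrals.\<close>
  unfolding multiperiod_perm_def multiperiod_eq_ordered_integral assms(4)[symmetric]
  using assms(3,4) by (intro shuffle_ordered_integral integrable_cusp_form_polynomial) auto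

end
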